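(* Let $\mathcal{F}$ be a second-countable, locally compact Hausdorff space and let $\mathcal{L} : \mathcal{F}\times\mathcal{F} \to [0,\infty)$ be a Lagrangian which is continuous and of compact range. Let $\rho$ be a Borel measure on $\mathcal{F}$ obtained by the exhaustion construction described in the context. Then $\rho$ satisfies the Euler-Lagrange equations $$\ell|_{\operatorname{supp}\rho} \equiv \inf_{x\in\mathcal{F}} \ell(x) = 0\,,$$ where $\ell\in C(\mathcal{F})$ is defined by $$\ell(x) := \int_{\mathcal{F}} \mathcal{L}(x,y)\,d\rho(y) - 1\,.$$
   Context: A Borel measure is a locally finite measure on the Borel $\sigma$-algebra $\mathcal{B}(\mathcal{F})$ with values in $[0,\infty]$. The support of $\rho$ is the complement of the union of all open sets of $\rho$-measure zero. Lagrangian: a symmetric, lower semi-continuous function $\mathcal{L}:\mathcal{F}\times\mathcal{F}\to[0,\infty)$ with $\mathcal{L}(x,x)>0$ for all $x\in\mathcal{F}$. It has compact range if for every compact $K\subset\mathcal{F}$ there is a compact $K'\subset\mathcal{F}$ such that $\mathcal{L}(x,y)=0$ for all $x\in K$ and $y\notin K'$. Exhaustion construction. For compact $K\subset\mathcal{F}$ let $\mathfrak{M}_K$ be the set of Borel measures $\mu$ on $K$ with $\mu(K)=1$, and $\mathcal{S}_K(\mu)=\int_K\int_K\mathcal{L}(x,y)\,d\mu(x)\,d\mu(y)$; minimizers of $\mathcal{S}_K$ in $\mathfrak{M}_K$ exist for nonempty $K$. Let $(K_n)_{n\in\mathbb{N}}$ be an exhaustion of $\mathcal{F}$ by nonempty compact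 sets with $K_n\subset K_{n+1}^\circ$ and $\bigcup_n K_n=\mathcal{F}$. For each $n$ let $\mu_n\in\mathfrak{M}_{K_n}$ be a minimizer of $\mathcal{S}_{K_n}$, put $\mathfrak{s}_n:=\inf_{x\in K_n}\int_{K_n}\mathcal{L}(x,y)\,d\mu_n(y)>0$, $\lambda_n:=1/\mathfrak{s}_n$, and $\rho^{[n]}(A):=\lambda_n\,\mu_n(A\cap K_n)$ for $A\in\mathcal{B}(\mathcal{F})$. With this scaling, $\int_{\mathcal{F}}\mathcal{L}(x,y)\,d\rho^{[n]}(y)\ge 1$ for all $x\in K_n$, with equality on $\operatorname{supp}\rho^{[n]}$. The sequence $(\rho^{[n]}(K))_n$ is bounded for each compact $K$; by a diagonal argument one chooses a subsequence, denoted $(\rho^{(k)})_{k\in\mathbb{N}}$ (with the exhaustion relabeled so that $\rho^{(k)}$ is the rescaled minimizer on $K_k$), such that for every $m$ the restrictions $\rho^{(k)}|_{K_m}$ converge weakly as $k\to\infty$. Then $\rho$ is the (unique) Radon measure on $\mathcal{F}$ which is the vague limit of $(\rho^{(k)})$, i.e. $\int f\,d\rho^{(k)}\to\int f\,d\rho$ for all $f\in C_c(\mathcal{F})$. *)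

theory Defs
  imports "HOL-Analysis.Analysis"
begin

text \<open>The space \<open>\<F>\<close> is the type \<open>'a\<close>, second countable and Hausdorff by its sort; local
  compactness is the assumption \<open>locally_compact_space euclidean\<close>.\<close>

definition lower_semicontinuous :: "('b::topological_space \<Rightarrow> real) \<Rightarrow> bool" where
  "lower_semicontinuous f \<longleftrightarrow> (\<forall>a. open {z. a < f z})"

definition lagrangian :: "('a::topological_space \<Rightarrow> 'a \<Rightarrow> real) \<Rightarrow> bool" where
  "lagrangian L \<longleftrightarrow>
     (\<forall>x y. 0 \<le> L x y) \<and> (\<forall>x y. L x y = L y x) \<and>
     lower_semicontinuous (\<lambda>(x, y). L x y) \<and> (\<forall>x. 0 < L x x)"

definition compact_range :: "('a::topological_space \<Rightarrow> 'a \<Rightarrow> real) \<Rightarrow> bool" where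
  "compact_range L \<longleftrightarrow>
     (\<forall>K. compact K \<longrightarrow> (\<exists>K'. compact K' \<and> (\<forall>x\<in>K. \<forall>y. y \<notin> K' \<longrightarrow> L x y = 0)))"

definition borel_measure :: "'a::topological_space measure \<Rightarrow> bool" where
  "borel_measure M \<longleftrightarrow>
     sets M = sets borel \<and> (\<forall>x. \<exists>U. open U \<and> x \<in> U \<and> emeasure M U < \<infinity>)"

definition radon_measure :: "'a::topological_space measure \<Rightarrow> bool" where
  "radon_measure M \<longleftrightarrow>
     borel_measure M \<and>
     (\<forall>A\<in>sets borel. emeasure M A = (SUP C\<in>{C. C \<subseteq> A \<and> compact C}. emeasure M C))"

definition measure_support :: "'a::topological_space measure \<Rightarrow> 'a set" where
  "measure_support M = - \<Union>{U. open U \<and> emeasure M U = 0}"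

text \<open>Borel measures on \<open>K\<close> live on the trace \<open>\<sigma>\<close>-algebra, so that their space is \<open>K\<close> itself and
  integration over the space is integration over \<open>K\<close>. Total mass 1 makes local finiteness
  automatic.\<close>

definition normalized_measures :: "'a::topological_space set \<Rightarrow> 'a measure set" where
  "normalized_measures K = {\<mu>. sets \<mu> = sets (restrict_space borel K) \<and> emeasure \<mu> K = 1}"

definition action :: "('a \<Rightarrow> 'a \<Rightarrow> real) \<Rightarrow> 'a measure \<Rightarrow> ennreal" where
  "action L \<mu> = (\<integral>\<^sup>+ y. (\<integral>\<^sup>+ x. ennreal (L x y) \<partial>\<mu>) \<partial>\<mu>)"

definition action_minimizer ::
    "('a::topological_space \<Rightarrow> 'a \<Rightarrow> real) \<Rightarrow> 'a set \<Rightarrow> 'a measure \<Rightarrow> bool" where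
  "action_minimizer L K \<mu> \<longleftrightarrow>
     \<mu> \<in> normalized_measures K \<and> (\<forall>\<nu>\<in>normalized_measures K. action L \<mu> \<le> action L \<nu>)"

definition compact_exhaustion :: "(nat \<Rightarrow> 'a::topological_space set) \<Rightarrow> bool" where
  "compact_exhaustion K \<longleftrightarrow>
     (\<forall>n. compact (K n) \<and> K n \<noteq> {} \<and> K n \<subseteq> interior (K (Suc n))) \<and> (\<Union>n. K n) = UNIV"

definition min_potential :: "('a \<Rightarrow> 'a \<Rightarrow> real) \<Rightarrow> 'a set \<Rightarrow> 'a measure \<Rightarrow> ennreal" where
  "min_potential L K \<mu> = (INF x\<in>K. \<integral>\<^sup>+ y. ennreal (L x y) \<partial>\<mu>)"

text \<open>The image of \<open>\<mu>\<close> under the inclusion of \<open>K\<close> is \<open>A \<mapsto> \<mu> (A \<inter> K)\<close>; the lemma below confirms the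
  resulting formula for the rescaled measure. The quotient is taken in \<open>ennreal\<close>.\<close>

definition rescaled ::
    "('a::topological_space \<Rightarrow> 'a \<Rightarrow> real) \<Rightarrow> 'a set \<Rightarrow> 'a measure \<Rightarrow> 'a measure" where
  "rescaled L K \<mu> = scale_measure (1 / min_potential L K \<mu>) (distr \<mu> borel (\<lambda>x. x))"

lemma emeasure_rescaled:
  assumes "\<mu> \<in> normalized_measures K" and "A \<in> sets borel"
  shows "emeasure (rescaled L K \<mu>) A = (1 / min_potential L K \<mu>) * emeasure \<mu> (A \<inter> K)"
proof -
  have s: "sets \<mu> = sets (restrict_space borel K)"
    using assms(1) by (simp add: normalized_measures_def)
  then have "space \<mu> = K"
    by (metis sets_eq_imp_space_eq space_restrict_space2 space_restrict_space space_borel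
        Int_UNIV_right)
  moreover have "(\<lambda>x. x) \<in> \<mu> \<rightarrow>\<^sub>M borel"
    by (subst measurable_cong_sets[OF s refl]) (rule measurable_restrict_space1, simp)
  ultimately show ?thesis
    using assms(2) by (simp add: rescaled_def emeasure_distr)
qed

text \<open>Weak convergence of the restrictions \<open>M k|\<^sub>K\<close> to some finite Borel measure on \<open>K\<close>.\<close>

definition restrictions_converge_weakly ::
    "(nat \<Rightarrow> 'a::topological_space measure) \<Rightarrow> 'a set \<Rightarrow> bool" where
  "restrictions_converge_weakly M K \<longleftrightarrow>
     (\<exists>\<nu>. sets \<nu> = sets (restrict_space borel K) \<and> finite_measure \<nu> \<and>
       (\<forall>f::'a \<Rightarrow> real. continuous_on K f \<and> bounded (f ` K) \<longrightarrow>
          (\<lambda>k. integral\<^sup>L (restrict_space (M k) K) f) \<longlonglongrightarrow> integral\<^sup>L \<nu> f))"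

definition vague_limit ::
    "(nat \<Rightarrow> 'a::topological_space measure) \<Rightarrow> 'a measure \<Rightarrow> bool" where
  "vague_limit M N \<longleftrightarrow>
     (\<forall>f::'a \<Rightarrow> real. continuous_on UNIV f \<and> compact (closure {x. f x \<noteq> 0}) \<longrightarrow>
        (\<lambda>k. integral\<^sup>L (M k) f) \<longlonglongrightarrow> integral\<^sup>L N f)"

definition ell :: "('a \<Rightarrow> 'a \<Rightarrow> real) \<Rightarrow> 'a measure \<Rightarrow> 'a \<Rightarrow> real" where
  "ell L \<rho> x = (\<integral> y. L x y \<partial>\<rho>) - 1"

end

theory Submission
  imports Defs "HOL-Probability.Probability_Mass_Function"
begin

text \<open>Varying a minimizer towards a point mass shows that its potential is at least the minimal action
  \<open>S\<close> on \<open>K\<close>; since the potential has mean \<open>S\<close>, it equals \<open>S\<close> almost everywhere, and \<open>S > 0\<close> because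
  \<open>L\<close> is positive near the diagonal. Hence the rescaled potentials are at least 1 on \<open>K\<close>, and open sets
  where they exceed 1 are null. By compact range the sections \<open>L x\<close> are test functions for vague
  convergence, which gives \<open>\<ell> \<ge> 0\<close>. If \<open>\<ell> x > 0\<close>, then by equicontinuity of the potentials at \<open>x\<close>
  a fixed neighbourhood of \<open>x\<close> is eventually null, so \<open>x\<close> is not in the support of the limit. The
  support is nonempty since the zero measure would give \<open>\<ell> = -1\<close>.\<close>

section \<open>Variation towards a point mass\<close>

text \<open>The convex combination of a point mass and \<open>M\<close> is built as a monadic bind:
  a Bernoulli variable selects \<open>return M x\<close> or \<open>M\<close>, and the integral
  formula is that of the bind. Equality of the sigma-algebras makes it a competitor of a
  minimizer.\<close>

lemma point_mass_mixture:
  assumes "prob_space M" "x \<in> space M" "0 \<le> t" "t \<le> 1"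
  obtains N where "sets N = sets M"
    and "\<And>f. f \<in> borel_measurable M \<Longrightarrow>
      (\<integral>\<^sup>+y. f y \<partial>N) = ennreal t * f x + ennreal (1 - t) * (\<integral>\<^sup>+y. f y \<partial>M)"
proof -
  interpret prob_space M by fact
  define k where "k b = (if b then return M x else M)" for b
  define N where "N = measure_pmf (bernoulli_pmf t) \<bind> k"
  have k: "k \<in> measure_pmf (bernoulli_pmf t) \<rightarrow>\<^sub>M subprob_algebra M"
    using assms(2) prob_space_return[OF assms(2)]
    by (auto simp: k_def space_subprob_algebra prob_space_imp_subprob_space prob_space_axioms)
  show thesis
  proof
    show "sets N = sets M"
      unfolding N_def by (rule sets_bind) (auto simp: k_def)
    fix f :: "'a \<Rightarrow> ennreal" assume f: "f \<in> borel_measurable M"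
    show "(\<integral>\<^sup>+y. f y \<partial>N) = ennreal t * f x + ennreal (1 - t) * (\<integral>\<^sup>+y. f y \<partial>M)"
      unfolding N_def using assms f
      by (subst nn_integral_bind[OF f k]) (simp add: k_def nn_integral_return mult.commute)
  qed
qed

text \<open>The right-hand side is the action of the mixture, with \<open>l\<close> the
  self-interaction \<open>L x x\<close>, \<open>p\<close> the potential at \<open>x\<close> and
  \<open>S\<close> the action of the minimizer. Comparing first-order terms as t tends to 0 gives
  the claim.\<close>

lemma first_variation_nonneg:
  fixes S p l :: real
  assumes "\<And>t. 0 < t \<Longrightarrow> t < 1 \<Longrightarrow>
    S \<le> t * (t * l + (1 - t) * p) + (1 - t) * (t * p + (1 - t) * S)"
  shows "S \<le> p"
proof -
  have "2 * S \<le> 2 * p"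
  proof (rule tendsto_le[OF trivial_limit_at_right_real])
    show "((\<lambda>t. (2 - t) * S) \<longlongrightarrow> 2 * S) (at_right 0)"
      by (rule tendsto_eq_intros | simp)+
    show "((\<lambda>t. t * l + 2 * (1 - t) * p) \<longlongrightarrow> 2 * p) (at_right 0)"
      by (rule tendsto_eq_intros | simp)+
    show "\<forall>\<^sub>F t in at_right 0. (2 - t) * S \<le> t * l + 2 * (1 - t) * p"
    proof (rule eventually_at_rightI[of 0 1])
      fix t :: real assume "t \<in> {0<..<1}"
      then have t: "0 < t" "t < 1" by auto
      \<comment> \<open>Moving the last term to the left leaves (1 - (1 - t)^2) S = t (2 - t) S, so
        both sides have the factor t.\<close>
      have "t * ((2 - t) * S) \<le> t * (t * l + 2 * (1 - t) * p)"
        using assms[OF t] by (simp add: algebra_simps power2_eq_square)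
      then show "(2 - t) * S \<le> t * l + 2 * (1 - t) * p"
        using t by simp
    qed simp
  qed
  then show ?thesis by simp
qed

section \<open>Minimizers on one compact set\<close>

context
  fixes L :: "'a::{second_countable_topology, t2_space} \<Rightarrow> 'a \<Rightarrow> real"
  assumes lagr: "lagrangian L"
    and cont: "continuous_on UNIV (\<lambda>(x, y). L x y)"
begin

lemma L_nonneg: "0 \<le> L x y" and L_sym: "L x y = L y x" and L_diag: "0 < L x x"
  using lagr unfolding lagrangian_def by auto

lemma L_cont: "continuous_on UNIV (L x)"
proof -
  have "continuous_on UNIV ((\<lambda>(x, y). L x y) \<circ> (\<lambda>y. (x, y)))"
    by (intro continuous_on_compose continuous_intros continuous_on_subset[OF cont]) auto
  then show ?thesis by (simp add: comp_def)
qed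

lemma L_measurable_pair [measurable]:
  "(\<lambda>(x, y). L x y) \<in> borel_measurable (borel \<Otimes>\<^sub>M borel)"
  using borel_measurable_continuous_onI[OF cont] by (simp add: borel_prod)

lemma L_measurable_comp [measurable (raw)]:
  assumes "f \<in> borel_measurable M" "g \<in> borel_measurable M"
  shows "(\<lambda>z. L (f z) (g z)) \<in> borel_measurable M"
  using measurable_compose[OF measurable_Pair[OF assms] L_measurable_pair] by simp

text \<open>Such sets serve as a finite cover of \<open>K\<close>: if the action vanished, each of
  them would be null, contradicting total mass 1.\<close>

lemma positive_neighbourhood:
  obtains U where "open U" "x \<in> U" "\<And>a b. a \<in> U \<Longrightarrow> b \<in> U \<Longrightarrow> 0 < L a b"
proof -
  have "open {z. 0 < (case z of (a, b) \<Rightarrow> L a b)}"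
    using lagr by (auto simp: lagrangian_def lower_semicontinuous_def)
  then obtain A B where "open A" "open B" "(x, x) \<in> A \<times> B"
      "A \<times> B \<subseteq> {z. 0 < (case z of (a, b) \<Rightarrow> L a b)}"
    using L_diag[of x] by (elim open_prod_elim) auto
  then show thesis by (intro that[of "A \<inter> B"]) auto
qed

lemma minimizer_potential:
  assumes K: "compact K" and min: "action_minimizer L K \<mu>"
  obtains s where "0 < s" and "min_potential L K \<mu> = ennreal s"
    and "\<And>x. x \<in> K \<Longrightarrow> ennreal s \<le> (\<integral>\<^sup>+y. L x y \<partial>\<mu>)"
    and "AE x in \<mu>. (\<integral>\<^sup>+y. L x y \<partial>\<mu>) = ennreal s"
proof -
  have sets: "sets \<mu> = sets (restrict_space borel K)" and "emeasure \<mu> K = 1"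
    using min by (auto simp: action_minimizer_def normalized_measures_def)
  moreover have space: "space \<mu> = K"
    using sets_eq_imp_space_eq[OF sets] by (simp add: space_restrict_space)
  ultimately interpret prob_space \<mu> by (intro prob_spaceI) simp
  have id [measurable]: "(\<lambda>x. x) \<in> borel_measurable \<mu>"
    by (subst measurable_cong_sets[OF sets refl]) (rule measurable_restrict_space1, simp)
  define \<phi> where "\<phi> x = (\<integral>\<^sup>+y. L x y \<partial>\<mu>)" for x
  have \<phi>_meas [measurable]: "\<phi> \<in> borel_measurable \<mu>"
    unfolding \<phi>_def by measurable
  have \<phi>': "(\<integral>\<^sup>+y. L y x \<partial>\<mu>) = \<phi> x" for x
    by (simp add: \<phi>_def L_sym)
  have action: "action L \<mu> = (\<integral>\<^sup>+y. \<phi> y \<partial>\<mu>)"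
    by (simp add: action_def \<phi>')
  \<comment> \<open>Boundedness on \<open>K \<times> K\<close> makes the potential and the action
    finite, so the variation can be carried out with real numbers.\<close>
  obtain B where B: "\<And>x y. x \<in> K \<Longrightarrow> y \<in> K \<Longrightarrow> L x y \<le> B"
  proof -
    have "compact ((\<lambda>(x, y). L x y) ` (K \<times> K))"
      by (intro compact_continuous_image compact_Times K continuous_on_subset[OF cont]) auto
    then obtain B where "\<forall>z \<in> (\<lambda>(x, y). L x y) ` (K \<times> K). norm z \<le> B"
      using compact_imp_bounded bounded_iff by blast
    then show thesis by (intro that[of B]) force
  qed
  have fin: "\<phi> x \<le> ennreal B" if "x \<in> K" for x
  proof -
    have "\<phi> x \<le> (\<integral>\<^sup>+y. ennreal B \<partial>\<mu>)"
      unfolding \<phi>_def by (intro nn_integral_mono ennreal_leI B that) (simp add: space)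
    then show ?thesis by (simp add: emeasure_space_1)
  qed
  have "(\<integral>\<^sup>+y. \<phi> y \<partial>\<mu>) \<le> (\<integral>\<^sup>+y. ennreal B \<partial>\<mu>)"
    by (intro nn_integral_mono fin) (simp add: space)
  then have "(\<integral>\<^sup>+y. \<phi> y \<partial>\<mu>) < \<infinity>"
    by (simp add: emeasure_space_1 le_less_trans)
  then obtain S where S0: "0 \<le> S" and S: "(\<integral>\<^sup>+y. \<phi> y \<partial>\<mu>) = ennreal S"
    by (cases "(\<integral>\<^sup>+y. \<phi> y \<partial>\<mu>)") auto
  have lower: "ennreal S \<le> \<phi> x" if x: "x \<in> K" for x
  proof -
    obtain p where p: "0 \<le> p" "\<phi> x = ennreal p"
      using fin[OF x] by (cases "\<phi> x") (auto simp: top_unique)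
    have "S \<le> p"
    proof (rule first_variation_nonneg)
      fix t :: real assume t: "0 < t" "t < 1"
      obtain N where N: "sets N = sets \<mu>" and int:
        "\<And>f. f \<in> borel_measurable \<mu> \<Longrightarrow>
          (\<integral>\<^sup>+y. f y \<partial>N) = ennreal t * f x + ennreal (1 - t) * (\<integral>\<^sup>+y. f y \<partial>\<mu>)"
        using point_mass_mixture[OF prob_space_axioms, of x t] x t by (auto simp: space)
      have "emeasure N K = (\<integral>\<^sup>+y. 1 \<partial>N)"
        using sets_eq_imp_space_eq[OF N] by (simp add: space)
      also have "\<dots> = ennreal t + ennreal (1 - t)"
        by (subst int) (simp_all add: emeasure_space_1)
      also have "\<dots> = 1"
        using t by (simp flip: ennreal_plus)
      finally have "N \<in> normalized_measures K"
        by (simp add: normalized_measures_def N sets)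
      then have "ennreal S \<le> action L N"
        using min by (auto simp: action_minimizer_def action S)
      \<comment> \<open>The mixture formula is applied to the inner integral, then to the outer one.
        By symmetry of \<open>L\<close> both cross terms are the potential at
        \<open>x\<close>.\<close>
      also have "\<dots> = (\<integral>\<^sup>+y. ennreal t * L x y + ennreal (1 - t) * \<phi> y \<partial>N)"
        unfolding action_def by (subst int) (simp_all add: \<phi>')
      also have "\<dots> = ennreal t * (ennreal t * L x x + ennreal (1 - t) * \<phi> x)
          + ennreal (1 - t) * (ennreal t * \<phi> x + ennreal (1 - t) * ennreal S)"
        by (subst int) (simp_all add: nn_integral_add nn_integral_cmult S flip: \<phi>_def)
      also have "\<dots> = ennreal (t * (t * L x x + (1 - t) * p) + (1 - t) * (t * p + (1 - t) * S))"
        using t p S0 L_nonneg[of x x]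
        by (simp add: ennreal_mult ennreal_plus)
      finally show "S \<le> t * (t * L x x + (1 - t) * p) + (1 - t) * (t * p + (1 - t) * S)"
        using t p S0 L_nonneg[of x x] by (subst (asm) ennreal_le_iff) auto
    qed
    then show ?thesis by (simp add: p ennreal_leI)
  qed
  \<comment> \<open>Subtraction in \<open>ennreal\<close> is truncated, but \<open>lower\<close>
    makes it a genuine difference here. Its integral vanishes since \<phi> has mean \<open>S\<close>
    and the mass is 1.\<close>
  have "(\<integral>\<^sup>+x. \<phi> x - ennreal S \<partial>\<mu>) = 0"
    by (subst nn_integral_diff) (auto simp: S \<open>emeasure \<mu> K = 1\<close> space lower)
  then have "AE x in \<mu>. \<phi> x - ennreal S = 0"
    by (subst (asm) nn_integral_0_iff_AE) auto
  then have AE: "AE x in \<mu>. \<phi> x = ennreal S"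
    using AE_space by eventually_elim
      (metis space lower diff_eq_0_iff_ennreal antisym ennreal_less_top less_top)
  have "S \<noteq> 0"
  proof
    assume "S = 0"
    have null: "emeasure \<mu> (U \<inter> K) = 0"
      if U: "open U" "\<And>a b. a \<in> U \<Longrightarrow> b \<in> U \<Longrightarrow> 0 < L a b" for U
    proof -
      \<comment> \<open>Zero potential at \<open>x\<close> forces \<open>L x\<close> to vanish
        almost everywhere, although it is positive on \<open>U\<close>.\<close>
      have "AE y in \<mu>. y \<notin> U" if "x \<in> U" "\<phi> x = 0" for x
      proof -
        have "AE y in \<mu>. ennreal (L x y) = 0"
          using that(2) by (simp add: \<phi>_def nn_integral_0_iff_AE)
        then show ?thesis
          by eventually_elim (use U(2) \<open>x \<in> U\<close> in \<open>force simp: ennreal_eq_0_iff\<close>)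
      qed
      \<comment> \<open>If no point of \<open>U\<close> has zero potential, then \<open>U\<close> is
        null because \<phi> = 0 almost everywhere.\<close>
      then have "AE x in \<mu>. x \<notin> U"
        using AE \<open>S = 0\<close> by (cases "\<exists>x\<in>U. \<phi> x = 0") (blast, auto elim!: eventually_mono)
      then have "emeasure \<mu> {x \<in> space \<mu>. x \<in> U} = 0" by (rule emeasure_eq_0_AE)
      moreover have "{x \<in> space \<mu>. x \<in> U} = U \<inter> K" by (auto simp: space)
      ultimately show ?thesis by simp
    qed
    obtain U where U: "\<And>x. open (U x)" "\<And>x. x \<in> U x"
        "\<And>x a b. a \<in> U x \<Longrightarrow> b \<in> U x \<Longrightarrow> 0 < L a b"
    proof -
      have "\<forall>x. \<exists>U. open U \<and> x \<in> U \<and> (\<forall>a\<in>U. \<forall>b\<in>U. 0 < L a b)"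
        using positive_neighbourhood by (metis (no_types))
      then show thesis using that by metis
    qed
    have "K \<subseteq> (\<Union>x\<in>K. U x)" using U(2) by auto
    then obtain D where D: "finite D" "K \<subseteq> (\<Union>x\<in>D. U x)"
      by (rule compactE_image[OF K U(1)])
    have "emeasure \<mu> K \<le> emeasure \<mu> (\<Union>x\<in>D. U x \<inter> K)"
      using D U(1) by (intro emeasure_mono) (auto simp: sets sets_restrict_space)
    also have "\<dots> \<le> (\<Sum>x\<in>D. emeasure \<mu> (U x \<inter> K))"
      using D(1) U(1) by (intro emeasure_subadditive_finite) (auto simp: sets sets_restrict_space)
    also have "\<dots> = 0"
      by (intro sum.neutral ballI null U(1)) (rule U(3))
    finally show False using \<open>emeasure \<mu> K = 1\<close> by simp
  qed
  have "min_potential L K \<mu> = ennreal S"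
    unfolding min_potential_def
  proof (rule antisym)
    \<comment> \<open>A property holding almost everywhere for a probability measure holds at some
      point, so the infimum is attained.\<close>
    have "AE x in \<mu>. \<phi> x = ennreal S \<and> x \<in> K"
      using AE AE_space by eventually_elim (simp add: space)
    then obtain x where "x \<in> K" "\<phi> x = ennreal S"
      using eventually_happens'[OF ae_filter_bot] by blast
    then show "(INF x\<in>K. \<integral>\<^sup>+y. L x y \<partial>\<mu>) \<le> ennreal S"
      by (metis INF_lower \<phi>_def)
    show "ennreal S \<le> (INF x\<in>K. \<integral>\<^sup>+y. L x y \<partial>\<mu>)"
      using lower by (intro INF_greatest) (simp add: \<phi>_def)
  qed
  with \<open>S \<noteq> 0\<close> S0 lower AE show thesis
    by (intro that[of S]) (auto simp: \<phi>_def)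
qed

text \<open>Multiplying by 1/s normalizes the constant potential to 1. Equality on the support is
  phrased through null open sets: an open set where the rescaled potential exceeds 1 misses almost
  every point of \<open>K\<close>. This form passes to the limit more easily.\<close>

lemma rescaled_minimizer:
  assumes K: "compact K" and min: "action_minimizer L K \<mu>"
  shows "finite_measure (rescaled L K \<mu>)"
    and "x \<in> K \<Longrightarrow> 1 \<le> (\<integral>\<^sup>+y. L x y \<partial>rescaled L K \<mu>)"
    and "open U \<Longrightarrow> (\<And>x. x \<in> U \<Longrightarrow> 1 < (\<integral>\<^sup>+y. L x y \<partial>rescaled L K \<mu>)) \<Longrightarrow>
      emeasure (rescaled L K \<mu>) U = 0"
proof -
  have norm: "\<mu> \<in> normalized_measures K"
    using min by (simp add: action_minimizer_def)
  then have sets: "sets \<mu> = sets (restrict_space borel K)" and one: "emeasure \<mu> K = 1"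
    by (auto simp: normalized_measures_def)
  have id [measurable]: "(\<lambda>x. x) \<in> borel_measurable \<mu>"
    by (subst measurable_cong_sets[OF sets refl]) (rule measurable_restrict_space1, simp)
  obtain s where s: "0 < s" "min_potential L K \<mu> = ennreal s"
    and lower: "\<And>x. x \<in> K \<Longrightarrow> ennreal s \<le> (\<integral>\<^sup>+y. L x y \<partial>\<mu>)"
    and AE: "AE x in \<mu>. (\<integral>\<^sup>+y. L x y \<partial>\<mu>) = ennreal s"
    using minimizer_potential[OF assms] by blast
  have inv: "1 / min_potential L K \<mu> = ennreal (1 / s)"
    using s divide_ennreal[of 1 s] by simp
  have unit: "ennreal (1 / s) * ennreal s = 1"
    using s by (simp flip: ennreal_mult)
  have pot: "(\<integral>\<^sup>+y. L x y \<partial>rescaled L K \<mu>) = ennreal (1 / s) * (\<integral>\<^sup>+y. L x y \<partial>\<mu>)" for x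
    unfolding rescaled_def inv by (subst nn_integral_scale_measure) (simp_all add: nn_integral_distr)
  show "finite_measure (rescaled L K \<mu>)"
  proof
    have "space (rescaled L K \<mu>) = UNIV"
      by (simp add: rescaled_def space_scale_measure)
    then show "emeasure (rescaled L K \<mu>) (space (rescaled L K \<mu>)) \<noteq> \<infinity>"
      by (simp add: emeasure_rescaled[OF norm] inv one)
  qed
  show "1 \<le> (\<integral>\<^sup>+y. L x y \<partial>rescaled L K \<mu>)" if "x \<in> K"
    using mult_left_mono[OF lower[OF that], of "ennreal (1 / s)"] by (simp add: pot unit)
  show "emeasure (rescaled L K \<mu>) U = 0"
    if U: "open U" "\<And>x. x \<in> U \<Longrightarrow> 1 < (\<integral>\<^sup>+y. L x y \<partial>rescaled L K \<mu>)"
  proof -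
    have "AE x in \<mu>. x \<notin> U"
      using AE by eventually_elim (use U(2) in \<open>force simp: pot unit\<close>)
    then have "emeasure \<mu> {x \<in> space \<mu>. x \<in> U} = 0"
      by (rule emeasure_eq_0_AE)
    moreover have "{x \<in> space \<mu>. x \<in> U} = U \<inter> K"
      using sets_eq_imp_space_eq[OF sets] by (auto simp: space_restrict_space)
    ultimately show ?thesis using U(1) by (simp add: emeasure_rescaled[OF norm])
  qed
qed

end

section \<open>Compact neighbourhoods and compactly supported functions\<close>

lemma compact_neighbourhood:
  fixes x :: "'a::topological_space"
  assumes "locally_compact_space (euclidean :: 'a topology)"
  obtains V Q where "open V" "compact Q" "x \<in> V" "V \<subseteq> Q"
proof -
  have "\<exists>V Q. openin euclidean V \<and> compactin euclidean Q \<and> x \<in> V \<and> V \<subseteq> Q"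
    using assms unfolding locally_compact_space_def topspace_euclidean by blast
  then show thesis
    using that unfolding compactin_euclidean_iff open_openin[symmetric] by blast
qed

lemma locally_finite_compact:
  assumes "borel_measure N" "compact C"
  shows "emeasure N C < \<infinity>"
proof -
  have sets: "sets N = sets borel"
    using assms by (simp add: borel_measure_def)
  obtain U where U: "\<And>x. open (U x)" "\<And>x. x \<in> U x" "\<And>x. emeasure N (U x) < \<infinity>"
    using assms(1) unfolding borel_measure_def by metis
  have "C \<subseteq> (\<Union>x\<in>C. U x)" using U(2) by auto
  then obtain D where D: "finite D" "C \<subseteq> (\<Union>x\<in>D. U x)"
    by (rule compactE_image[OF assms(2) U(1)])
  have "emeasure N C \<le> emeasure N (\<Union>x\<in>D. U x)"
    using D U(1) by (intro emeasure_mono) (auto simp: sets)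
  also have "\<dots> \<le> (\<Sum>x\<in>D. emeasure N (U x))"
    using D(1) U(1) by (intro emeasure_subadditive_finite) (auto simp: sets)
  also have "\<dots> < \<infinity>"
    using D(1) U(3) by (simp add: ennreal_sum_less_top)
  finally show ?thesis .
qed

lemma integrable_compactly_supported:
  fixes f :: "'a::t2_space \<Rightarrow> real"
  assumes N: "borel_measure N" and f: "continuous_on UNIV f"
    and C: "compact C" "\<And>y. y \<notin> C \<Longrightarrow> f y = 0"
  shows "integrable N f"
proof -
  have sets: "sets N = sets borel"
    using N by (simp add: borel_measure_def)
  have "compact (f ` C)"
    by (intro compact_continuous_image continuous_on_subset[OF f] C(1)) simp
  then obtain B where "\<forall>z\<in>f ` C. norm z \<le> B"
    using compact_imp_bounded bounded_iff by blast
  moreover have "f \<in> borel_measurable N"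
    using borel_measurable_continuous_onI[OF f] by (simp add: measurable_cong_sets[OF sets refl])
  ultimately show ?thesis
    using C locally_finite_compact[OF N C(1)]
    by (intro integrableI_bounded_set[where A = C and B = B])
       (auto simp: sets borel_compact)
qed

lemma compactly_supported:
  fixes f :: "'a::t2_space \<Rightarrow> real"
  assumes "compact C" "\<And>y. y \<notin> C \<Longrightarrow> f y = 0"
  shows "compact (closure {y. f y \<noteq> 0})"
proof -
  have "closure {y. f y \<noteq> 0} \<subseteq> C"
    using assms by (intro closure_minimal compact_imp_closed) auto
  then show ?thesis
    using compact_Int_closed[OF assms(1) closed_closure] by (metis inf.absorb_iff2)
qed

lemma finite_borel_measure:
  "finite_measure N \<Longrightarrow> sets N = sets borel \<Longrightarrow> borel_measure N"
  using finite_measure.emeasure_finite[of N UNIV] unfolding borel_measure_def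
  by (metis UNIV_I infinity_ennreal_def less_top open_UNIV)

section \<open>Potentials under compact range\<close>

context
  fixes L :: "'a::{second_countable_topology, t2_space} \<Rightarrow> 'a \<Rightarrow> real"
  assumes lagr: "lagrangian L"
    and cont: "continuous_on UNIV (\<lambda>(x, y). L x y)"
    and range: "compact_range L"
begin

lemma section_support:
  obtains C where "compact C" "\<And>y. y \<notin> C \<Longrightarrow> L x y = 0"
  using range compact_sing[of x] unfolding compact_range_def by (metis singletonI)

text \<open>Integrability rules out the default value 0 of the Bochner integral, so
  \<open>ell\<close> is the genuine potential minus 1 and agrees with the \<open>ennreal\<close>
  potentials of the minimizers.\<close>

lemma integrable_section: "borel_measure N \<Longrightarrow> integrable N (L x)"
proof -
  obtain C where "compact C" "\<And>y. y \<notin> C \<Longrightarrow> L x y = 0"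
    using section_support by blast
  then show "borel_measure N \<Longrightarrow> integrable N (L x)"
    using integrable_compactly_supported[OF _ L_cont[OF lagr cont]] by blast
qed

text \<open>The set \<open>C\<close> depends on \<open>x\<close> only, so the potentials of measures of uniformly bounded mass on
  \<open>C\<close> are equicontinuous at \<open>x\<close>.\<close>

lemma potential_equicontinuous:
  assumes "locally_compact_space (euclidean :: 'a topology)"
  obtains C where "compact C"
    and "\<And>e. 0 < e \<Longrightarrow> \<exists>U. open U \<and> x \<in> U \<and> (\<forall>N. borel_measure N \<longrightarrow>
      (\<forall>z\<in>U. \<bar>(\<integral>y. L z y \<partial>N) - (\<integral>y. L x y \<partial>N)\<bar> \<le> e * measure N C))"
proof -
  obtain V Q where V: "open V" "compact Q" "x \<in> V" "V \<subseteq> Q"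
    using compact_neighbourhood[OF assms] by metis
  \<comment> \<open>Compact range is applied to the whole neighbourhood \<open>Q\<close>, so that
    one \<open>C\<close> serves all sections \<open>L z\<close> with \<open>z\<close> near
    \<open>x\<close>.\<close>
  obtain C where C: "compact C" "\<And>z y. z \<in> Q \<Longrightarrow> y \<notin> C \<Longrightarrow> L z y = 0"
    using range V(2) unfolding compact_range_def by metis
  show thesis
  proof (rule that[OF C(1)])
    fix e :: real assume "0 < e"
    \<comment> \<open>Compactness of \<open>C\<close> makes continuity in the first variable uniform
      over the second.\<close>
    then obtain W where W: "x \<in> W" "open W"
        "\<forall>z\<in>W \<inter> UNIV. \<forall>y\<in>C. dist (case (z, y) of (x, y) \<Rightarrow> L x y) (case (x, y) of (x, y) \<Rightarrow> L x y) \<le> e"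
      using continuous_on_prod_compactE[OF continuous_on_subset[OF cont] C(1), of UNIV x e] by auto
    have "\<bar>(\<integral>y. L z y \<partial>N) - (\<integral>y. L x y \<partial>N)\<bar> \<le> e * measure N C"
      if z: "z \<in> V \<inter> W" and N: "borel_measure N" for z and N :: "'a measure"
    proof -
      have bound: "norm (L z y - L x y) \<le> e * indicator C y" for y
        using W(3) C(2)[of z y] C(2)[of x y] z V(3) subsetD[OF V(4)] by (cases "y \<in> C") (auto simp: dist_real_def)
      have "C \<in> sets N"
        using N C(1) by (simp add: borel_measure_def borel_compact)
      then have ind: "integrable N (\<lambda>y. e * indicator C y)" "(\<integral>y. e * indicator C y \<partial>N) = e * measure N C"
        using locally_finite_compact[OF N C(1)] \<open>C \<in> sets N\<close>[THEN sets.sets_into_space]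
        by (auto simp: Int_absorb2)
      have "(\<integral>y. L z y \<partial>N) - (\<integral>y. L x y \<partial>N) = (\<integral>y. L z y - L x y \<partial>N)"
        using integrable_section[OF N] by (simp add: Bochner_Integration.integral_diff)
      moreover have "(\<integral>y. norm (L z y - L x y) \<partial>N) \<le> (\<integral>y. e * indicator C y \<partial>N)"
        using integrable_section[OF N] ind(1) bound by (intro integral_mono) auto
      ultimately have "norm ((\<integral>y. L z y \<partial>N) - (\<integral>y. L x y \<partial>N)) \<le> e * measure N C"
        using integral_norm_bound[of N "\<lambda>y. L z y - L x y"] unfolding ind by (metis order_trans)
      then show ?thesis by simp
    qed
    then show "\<exists>U. open U \<and> x \<in> U \<and> (\<forall>N. borel_measure N \<longrightarrow>
        (\<forall>z\<in>U. \<bar>(\<integral>y. L z y \<partial>N) - (\<integral>y. L x y \<partial>N)\<bar> \<le> e * measure N C))"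
      using V W by (intro exI[of _ "V \<inter> W"]) blast
  qed
qed

lemma continuous_ell:
  assumes "locally_compact_space (euclidean :: 'a topology)" "borel_measure N"
  shows "continuous_on UNIV (ell L N)"
proof -
  have "isCont (ell L N) x" for x
    unfolding isCont_def tendsto_at_iff_tendsto_nhds
  proof (rule tendstoI)
    fix d :: real assume "0 < d"
    obtain C where C: "\<And>e. 0 < e \<Longrightarrow> \<exists>U. open U \<and> x \<in> U \<and> (\<forall>N. borel_measure N \<longrightarrow>
        (\<forall>z\<in>U. \<bar>(\<integral>y. L z y \<partial>N) - (\<integral>y. L x y \<partial>N)\<bar> \<le> e * measure N C))"
      using potential_equicontinuous[OF assms(1)] by metis
    \<comment> \<open>The summand 1 covers the case that \<open>C\<close> is null.\<close>
    define e where "e = d / (measure N C + 1)"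
    have e: "0 < e" "e * measure N C < d"
      using \<open>0 < d\<close> add_nonneg_pos[OF measure_nonneg[of N C] zero_less_one]
      by (simp_all add: e_def pos_divide_less_eq algebra_simps)
    then obtain U where "open U" "x \<in> U"
        "\<forall>z\<in>U. \<bar>(\<integral>y. L z y \<partial>N) - (\<integral>y. L x y \<partial>N)\<bar> \<le> e * measure N C"
      using C[of e] assms(2) by blast
    with e(2) show "\<forall>\<^sub>F z in nhds x. dist (ell L N z) (ell L N x) < d"
      unfolding eventually_nhds by (intro exI[of _ U]) (force simp: ell_def dist_real_def)
  qed
  then show ?thesis by (simp add: continuous_at_imp_continuous_on)
qed

lemma vague_limit_potential:
  fixes N :: "'a measure"
  assumes "vague_limit R N"
  shows "(\<lambda>k. \<integral>y. L x y \<partial>R k) \<longlonglongrightarrow> (\<integral>y. L x y \<partial>N)"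
proof -
  obtain C where "compact C" "\<And>y. y \<notin> C \<Longrightarrow> L x y = 0"
    using section_support by blast
  then have "compact (closure {y. L x y \<noteq> 0})"
    by (rule compactly_supported)
  then show ?thesis
    using assms L_cont[OF lagr cont, of x] unfolding vague_limit_def by blast
qed

text \<open>The neighbourhoods \<open>{y. L x x / 2 < L x y}\<close> have mass at most \<open>2 / L x x\<close> times the potential
  at \<open>x\<close>, and the potentials at a fixed point converge.\<close>

lemma vague_limit_mass_bounded:
  fixes N :: "'a measure"
  assumes R: "\<And>k. finite_measure (R k)" "\<And>k. sets (R k) = sets borel"
    and vague: "vague_limit R N" and C: "compact C"
  obtains M where "0 \<le> M" "\<And>k. measure (R k) C \<le> M"
proof -
  note R_borel = finite_borel_measure[OF R]
  define V where "V x = {y. L x x / 2 < L x y}" for x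
  have V: "open (V x)" "x \<in> V x" for x
    using L_diag[OF lagr cont] by (auto simp: V_def intro!: open_Collect_less continuous_intros L_cont[OF lagr cont])
  have "\<exists>B. \<forall>k. measure (R k) (V x) \<le> B" for x
  proof -
    obtain B where B: "\<And>k. norm (\<integral>y. L x y \<partial>R k) \<le> B"
      using convergent_imp_Bseq[OF convergentI[OF vague_limit_potential[OF vague]]]
      unfolding Bseq_def by blast
    have "measure (R k) (V x) \<le> B / (L x x / 2)" for k
    proof -
      interpret finite_measure "R k" by (rule R)
      have Vk: "V x \<in> sets (R k)" using V R by auto
      have "L x x / 2 * measure (R k) (V x) = (\<integral>y. L x x / 2 * indicator (V x) y \<partial>R k)"
        using sets.sets_into_space[OF Vk] by (simp add: Int_absorb2)
      also have "\<dots> \<le> (\<integral>y. L x y \<partial>R k)"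
      proof (intro integral_mono integrable_section R_borel)
        show "integrable (R k) (\<lambda>y. L x x / 2 * indicator (V x) y)"
          using Vk by (intro integrable_mult_right integrable_real_indicator) (simp_all add: emeasure_eq_measure)
        show "L x x / 2 * indicator (V x) y \<le> L x y" for y
          using L_nonneg[OF lagr cont, of x y] by (auto simp: V_def indicator_def)
      qed
      also have "\<dots> \<le> B" using B[of k] by simp
      finally show ?thesis using L_diag[OF lagr cont, of x] by (simp add: field_simps)
    qed
    then show ?thesis by blast
  qed
  then obtain B where B: "\<And>x k. measure (R k) (V x) \<le> B x" by metis
  have "C \<subseteq> (\<Union>x\<in>C. V x)" using V(2) by auto
  then obtain D where D: "finite D" "C \<subseteq> (\<Union>x\<in>D. V x)"
    by (rule compactE_image[OF C V(1)])
  show thesis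
  proof
    show "0 \<le> (\<Sum>x\<in>D. B x)"
      by (intro sum_nonneg order_trans[OF measure_nonneg B])
    fix k
    interpret finite_measure "R k" by (rule R)
    have "measure (R k) C \<le> measure (R k) (\<Union>x\<in>D. V x)"
      using D V R(2) by (intro finite_measure_mono) auto
    also have "\<dots> \<le> (\<Sum>x\<in>D. measure (R k) (V x))"
      using D(1) V R(2) by (intro finite_measure_subadditive_finite) auto
    also have "\<dots> \<le> (\<Sum>x\<in>D. B x)"
      by (intro sum_mono B)
    finally show "measure (R k) C \<le> (\<Sum>x\<in>D. B x)" .
  qed
qed

end

section \<open>Supports and vague limits\<close>

text \<open>A bump function at a point of \<open>U\<close>, supported compactly and vanishing off
  \<open>U\<close>, has eventually zero integral and hence zero integral in the limit. Its
  positivity set is then a null open neighbourhood of the point.\<close>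

lemma vague_limit_eventually_null:
  fixes U :: "'a::t2_space set"
  assumes lc: "locally_compact_space (euclidean :: 'a topology)"
    and R: "\<And>k. sets (R k) = sets borel" and N: "borel_measure N"
    and vague: "vague_limit R N"
    and U: "open U" "\<forall>\<^sub>F k in sequentially. emeasure (R k) U = 0"
  shows "U \<inter> measure_support N = {}"
proof -
  have "x \<notin> measure_support N" if x: "x \<in> U" for x
  proof -
    obtain V Q where V: "open V" "compact Q" "x \<in> V" "V \<subseteq> Q"
      using compact_neighbourhood[OF lc] by metis
    \<comment> \<open>Locally compact Hausdorff spaces are completely regular, which yields the
      separating function \<open>f\<close>.\<close>
    have "Hausdorff_space (euclidean :: 'a topology)"
      unfolding Hausdorff_space_def
    proof (intro allI impI)
      fix a b :: 'a assume "a \<in> topspace euclidean \<and> b \<in> topspace euclidean \<and> a \<noteq> b"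
      then obtain A B where "open A" "open B" "a \<in> A" "b \<in> B" "A \<inter> B = {}"
        using hausdorff[of a b] by blast
      then show "\<exists>A B. openin euclidean A \<and> openin euclidean B \<and> a \<in> A \<and> b \<in> B \<and> disjnt A B"
        by (intro exI[of _ A] exI[of _ B]) (simp add: disjnt_def open_openin[symmetric])
    qed
    then have "completely_regular_space (euclidean :: 'a topology)"
      using locally_compact_regular_imp_completely_regular_space[OF lc] by blast
    moreover have "closedin euclidean (- (U \<inter> V))" "x \<in> topspace euclidean - (- (U \<inter> V))"
      using U(1) V(1,3) x closed_Compl[OF open_Int[OF U(1) V(1)]] by simp_all
    ultimately obtain f :: "'a \<Rightarrow> real" where f: "continuous_map euclidean (top_of_set {0..1}) f"
        "f x = 0" "f ` (- (U \<inter> V)) \<subseteq> {1}"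
      unfolding completely_regular_space_def by meson
    \<comment> \<open>Flipping \<open>f\<close> gives value 1 at \<open>x\<close> and 0 off
      \<open>U \<inter> V\<close>; as \<open>V\<close> lies in the compact \<open>Q\<close>, this is
      a test function.\<close>
    define g where "g y = 1 - f y" for y
    have f_cont: "continuous_on UNIV f" and f_le: "f y \<le> 1" for y
      using f(1) by (auto simp: continuous_map_in_subtopology)
    have g: "continuous_on UNIV g" "g x = 1" "\<And>y. y \<notin> U \<Longrightarrow> g y = 0" "\<And>y. y \<notin> Q \<Longrightarrow> g y = 0"
        "\<And>y. 0 \<le> g y"
      using f V f_le unfolding g_def by (auto intro!: continuous_intros f_cont)
    have "(\<integral>y. g y \<partial>R k) = 0" if "emeasure (R k) U = 0" for k
    proof -
      have "AE y in R k. y \<notin> U"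
        using that U(1) R by (intro AE_not_in) (simp add: null_sets_def)
      then have "AE y in R k. g y = 0"
        by eventually_elim (rule g)
      then show ?thesis by (rule integral_eq_zero_AE)
    qed
    then have "\<forall>\<^sub>F k in sequentially. (\<integral>y. g y \<partial>R k) = 0"
      using U(2) by (auto elim: eventually_mono)
    then have "(\<lambda>k. \<integral>y. g y \<partial>R k) \<longlonglongrightarrow> 0"
      by (rule tendsto_eventually)
    moreover have "(\<lambda>k. \<integral>y. g y \<partial>R k) \<longlonglongrightarrow> (\<integral>y. g y \<partial>N)"
      using vague g compactly_supported[OF V(2), of g] by (auto simp: vague_limit_def)
    ultimately have "(\<integral>y. g y \<partial>N) = 0"
      using LIMSEQ_unique by blast
    then have "AE y in N. \<not> 0 < g y"
      using integral_nonneg_eq_0_iff_AE[OF integrable_compactly_supported[OF N g(1) V(2)]] g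
      by (auto elim!: eventually_mono)
    then have "emeasure N {y. 0 < g y} = 0"
      using emeasure_eq_0_AE[of "\<lambda>y. 0 < g y" N] sets_eq_imp_space_eq[of N borel] N
      by (auto simp: borel_measure_def)
    moreover have "open {y. 0 < g y}"
      by (intro open_Collect_less continuous_intros g(1))
    ultimately show ?thesis
      using g(2) by (auto simp: measure_support_def intro!: exI[of _ "{y. 0 < g y}"])
  qed
  then show ?thesis by blast
qed

text \<open>The union of all null open sets may be uncountable; the Lindelof property reduces it to
  a countable one.\<close>

lemma emeasure_compl_support:
  fixes N :: "'a::second_countable_topology measure"
  assumes "sets N = sets borel"
  shows "emeasure N (- measure_support N) = 0"
proof -
  obtain F where F: "F \<subseteq> {U. open U \<and> emeasure N U = 0}" "countable F"
      "\<Union>F = \<Union>{U. open U \<and> emeasure N U = 0}"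
    using Lindelof[of "{U. open U \<and> emeasure N U = 0}"] by auto
  have "(\<Union>U\<in>F. U) \<in> null_sets N"
    using F assms by (intro null_sets_UN') (auto simp: null_sets_def)
  then show ?thesis by (simp add: measure_support_def F(3) null_sets_def)
qed

section \<open>The Euler-Lagrange equations for the limit measure\<close>

theorem theorem4p2:
  fixes L :: "'a::{second_countable_topology, t2_space} \<Rightarrow> 'a \<Rightarrow> real"
    and K :: "nat \<Rightarrow> 'a set"
    and \<mu> :: "nat \<Rightarrow> 'a measure"
    and r :: "nat \<Rightarrow> nat"
    and \<rho> :: "'a measure"
  assumes "locally_compact_space (euclidean :: 'a topology)"
    and "lagrangian L"
    and "continuous_on UNIV (\<lambda>(x, y). L x y)"
    and "compact_range L"
    and "compact_exhaustion K"
    and "\<And>n. action_minimizer L (K n) (\<mu> n)"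
    and "strict_mono r"
    and "\<And>m. restrictions_converge_weakly
               (\<lambda>k. rescaled L (K (r k)) (\<mu> (r k))) (K (r m))"
    and "radon_measure \<rho>"
    and "vague_limit (\<lambda>k. rescaled L (K (r k)) (\<mu> (r k))) \<rho>"
  shows "(\<forall>x. integrable \<rho> (L x)) \<and>
         continuous_on UNIV (ell L \<rho>) \<and>
         (\<forall>x\<in>measure_support \<rho>. ell L \<rho> x = (INF z. ell L \<rho> z)) \<and>
         (INF z. ell L \<rho> z) = 0"
proof -
  let ?R = "\<lambda>k. rescaled L (K (r k)) (\<mu> (r k))"
  note lc = assms(1) and lagr = assms(2) and cont = assms(3) and range = assms(4)
    and vague = assms(10)
  have \<rho>: "borel_measure \<rho>" "sets \<rho> = sets borel"
    using assms(9) by (auto simp: radon_measure_def borel_measure_def)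
  have K: "compact (K n)" "K n \<subseteq> K (Suc n)" for n
    using assms(5) interior_subset unfolding compact_exhaustion_def by blast+
  have R_finite: "finite_measure (?R k)" for k
    by (intro rescaled_minimizer lagr cont K assms(6))
  have R_sets: "sets (?R k) = sets borel" for k
    by (simp add: rescaled_def)
  note R = finite_borel_measure[OF R_finite R_sets]
  note integrable = integrable_section[OF lagr cont range]
  have R_nn: "(\<integral>\<^sup>+y. L x y \<partial>?R k) = ennreal (\<integral>y. L x y \<partial>?R k)" for x k
    by (intro nn_integral_eq_integral integrable R) (simp add: L_nonneg[OF lagr cont])
  note lim = vague_limit_potential[OF lagr cont range vague]
  have nonneg: "0 \<le> ell L \<rho> x" for x
  proof -
    obtain n where "x \<in> K n"
      using assms(5) unfolding compact_exhaustion_def by blast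
    \<comment> \<open>A strictly increasing \<open>r\<close> satisfies \<open>k \<le> r k\<close>,
      and the exhaustion is increasing.\<close>
    then have "x \<in> K (r k)" if "n \<le> k" for k
      using lift_Suc_mono_le[of K n "r k"] K(2) that seq_suble[OF assms(7), of k] by fastforce
    then have "1 \<le> (\<integral>y. L x y \<partial>?R k)" if "n \<le> k" for k
      using rescaled_minimizer(2)[OF lagr cont K(1) assms(6), of x "r k"] that
      by (simp add: R_nn)
    then have "\<forall>\<^sub>F k in sequentially. 1 \<le> (\<integral>y. L x y \<partial>?R k)"
      unfolding eventually_sequentially by blast
    then have "1 \<le> (\<integral>y. L x y \<partial>\<rho>)"
      by (intro tendsto_lowerbound[OF lim]) auto
    then show ?thesis by (simp add: ell_def)
  qed
  have zero: "ell L \<rho> x = 0" if x: "x \<in> measure_support \<rho>" for x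
  proof (rule ccontr)
    assume "ell L \<rho> x \<noteq> 0"
    with nonneg[of x] have pos: "0 < ell L \<rho> x" by simp
    obtain C where C: "compact C" "\<And>e. 0 < e \<Longrightarrow> \<exists>U. open U \<and> x \<in> U \<and> (\<forall>N. borel_measure N \<longrightarrow>
        (\<forall>z\<in>U. \<bar>(\<integral>y. L z y \<partial>N) - (\<integral>y. L x y \<partial>N)\<bar> \<le> e * measure N C))"
      using potential_equicontinuous[OF lagr cont range lc] by metis
    obtain M where M: "0 \<le> M" "\<And>k. measure (?R k) C \<le> M"
      using vague_limit_mass_bounded[OF lagr cont range R_finite R_sets vague C(1)] by blast
    \<comment> \<open>With masses on \<open>C\<close> bounded by \<open>M\<close>, the potentials of
      all \<open>?R k\<close> vary from their value at \<open>x\<close> by less than half of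
      \<open>ell L \<rho> x\<close> on one common \<open>U\<close>. The summand 1 allows
      \<open>M = 0\<close>.\<close>
    define e where "e = ell L \<rho> x / (2 * (M + 1))"
    have e: "0 < e" "e * M < ell L \<rho> x / 2"
      using pos M(1) by (auto simp: e_def field_simps)
    obtain U where U: "open U" "x \<in> U" "\<And>N z. borel_measure N \<Longrightarrow> z \<in> U \<Longrightarrow>
        \<bar>(\<integral>y. L z y \<partial>N) - (\<integral>y. L x y \<partial>N)\<bar> \<le> e * measure N C"
      using C(2)[OF e(1)] by blast
    \<comment> \<open>The potentials at \<open>x\<close> tend to \<open>1 + ell L \<rho> x\<close>.
      Half of the excess over 1 is kept here; the other half absorbs the variation over
      \<open>U\<close>.\<close>
    have "\<forall>\<^sub>F k in sequentially. 1 + ell L \<rho> x / 2 < (\<integral>y. L x y \<partial>?R k)"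
      using pos by (intro order_tendstoD(1)[OF lim]) (simp add: ell_def field_simps)
    then have "\<forall>\<^sub>F k in sequentially. emeasure (?R k) U = 0"
    proof eventually_elim
      case (elim k)
      have "1 < (\<integral>y. L z y \<partial>?R k)" if "z \<in> U" for z
        using U(3)[OF R that, of k] elim e mult_left_mono[OF M(2)[of k], of e] by linarith
      then show ?case
        by (intro rescaled_minimizer(3)[OF lagr cont K(1) assms(6) U(1)]) (simp add: R_nn)
    qed
    then show False
      using vague_limit_eventually_null[OF lc R_sets \<rho>(1) vague U(1)] x U(2) by blast
  qed
  have "measure_support \<rho> \<noteq> {}"
  proof
    assume "measure_support \<rho> = {}"
    then have "AE y in \<rho>. y \<notin> UNIV"
      using emeasure_compl_support[OF \<rho>(2)] by (intro AE_not_in) (simp add: null_sets_def \<rho>)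
    then have "(\<integral>y. L x y \<partial>\<rho>) = 0" for x
      by (intro integral_eq_zero_AE) (auto elim: eventually_mono)
    \<comment> \<open>Any point would do: all potentials vanish, so \<open>ell\<close> is -1
      everywhere.\<close>
    then show False using nonneg[of undefined] by (simp add: ell_def)
  qed
  then obtain x where "x \<in> measure_support \<rho>" by blast
  \<comment> \<open>The infimum is taken in the reals; as an attained lower bound, 0 is its
    value.\<close>
  then have "0 \<in> range (ell L \<rho>)"
    using zero by (metis rangeI)
  then have "(INF z. ell L \<rho> z) = 0"
    using nonneg by (intro cInf_eq_minimum) auto
  with zero show ?thesis
    using integrable[OF \<rho>(1)] continuous_ell[OF lagr cont range lc \<rho>(1)] by simp
qed

end
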